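(* Let $F\colon\mathbb{B}^{2L}\to\mathbb{B}^{2L}$ be the Boolean Delta-Notch system over a graph $\mathcal{G}$ as in the context. Every fixed point of $F$ is reachable in the asynchronous dynamics $AD_F$ from every state $(n,d)\in\mathbb{B}^{2L}$ satisfying at least one of $n=\mathbf{0}$, $d=\mathbf{0}$, $n=\mathbf{1}$, $d=\mathbf{1}$ (where $\mathbf{0},\mathbf{1}\in\mathbb{B}^L$ are the all-zero and all-one vectors).
   Context: Let $L\ge 1$ and let $\mathcal{G}$ be an undirected connected graph without loops on the vertex set $C=\{1,\dots,L\}$. For $i\in C$ let $S(i)$ be the set of neighbours of $i$ in $\mathcal{G}$. $\mathbb{B}=\{0,1\}$. States of $\mathbb{B}^{2L}$ are written $(n,d)=(n_1,\dots,n_L,d_1,\dots,d_L)$. The Boolean Delta-Notch system is $F\colon\mathbb{B}^{2L}\to\mathbb{B}^{2L}$ with $F_i(n,d)=\bigvee_{j\in S(i)}d_j$ (empty disjunction $=0$) and $F_{i+L}(n,d)=1-n_i$ for $i\in C$. The asynchronous dynamics $AD_F$ is the directed graph on $\mathbb{B}^{2L}$ with an edge from $x$ to the state obtained from $x$ by flipping coordinate $i$ whenever $F_i(x)\neq x_i$. A state $y$ is reachable from $x$ if there is a directed path (possibly of length zero) from $x$ to $y$. A fixed point is $x$ with $F(x)=x$. *)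

theory Defs
  imports "Graph_Theory.Graph_Theory" "HOL-Library.FuncSet"
begin

text \<open>
  An undirected graph without loops is a symmetric, loop-free pair digraph (locale
  \<open>pair_graph\<close>): the edge between \<open>i\<close> and \<open>j\<close> is represented by both arcs \<open>(i, j)\<close> and \<open>(j, i)\<close>.
\<close>

definition neighbours :: "'a pair_pre_digraph \<Rightarrow> 'a \<Rightarrow> 'a set" where
  "neighbours G i = {j. (i, j) \<in> parcs G}"

text \<open>
  Elements of $\mathbb{B}^m$ are functions on the coordinates \<open>{1..m}\<close> that are \<open>undefined\<close> elsewhere,
  so that equality of states is equality of functions. \<open>True\<close> is 1 and \<open>False\<close> is 0.
\<close>

definition bool_states :: "nat \<Rightarrow> (nat \<Rightarrow> bool) set" where
  "bool_states m = {1..m} \<rightarrow>\<^sub>E UNIV"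

definition async_dynamics ::
    "nat \<Rightarrow> ((nat \<Rightarrow> bool) \<Rightarrow> (nat \<Rightarrow> bool)) \<Rightarrow> (nat \<Rightarrow> bool) pair_pre_digraph" where
  "async_dynamics m F =
    \<lparr>pverts = bool_states m,
     parcs = {(x, x(i := \<not> x i)) |x i. x \<in> bool_states m \<and> i \<in> {1..m} \<and> F x i \<noteq> x i}\<rparr>"

text \<open>
  In a state \<open>x\<close> of the Delta-Notch system, $n_i$ is \<open>x i\<close> and $d_i$ is \<open>x (i + L)\<close>,
  for \<open>i \<in> {1..L}\<close>.
\<close>

definition delta_notch :: "nat \<Rightarrow> nat pair_pre_digraph \<Rightarrow> (nat \<Rightarrow> bool) \<Rightarrow> (nat \<Rightarrow> bool)" where
  "delta_notch L G x =
    (\<lambda>k\<in>{1..2 * L}. if k \<le> L then (\<exists>j\<in>neighbours G k. x (j + L)) else \<not> x (k - L))"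

lemma delta_notch_in_bool_states: "delta_notch L G x \<in> bool_states (2 * L)"
  by (simp add: delta_notch_def bool_states_def)

lemma delta_notch_notch:
  "i \<in> {1..L} \<Longrightarrow> delta_notch L G x i \<longleftrightarrow> (\<exists>j\<in>neighbours G i. x (j + L))"
  by (simp add: delta_notch_def)

lemma delta_notch_delta:
  "i \<in> {1..L} \<Longrightarrow> delta_notch L G x (i + L) \<longleftrightarrow> \<not> x i"
  by (auto simp add: delta_notch_def)

lemma pair_wf_digraph_async_dynamics: "pair_wf_digraph (async_dynamics m F)"
  by unfold_locales
    (auto simp: async_dynamics_def bool_states_def PiE_iff extensional_def)

end

theory Submission
  imports Defs
begin

text \<open>
  In a fixed point, the cells with $d_i = 1$ form a maximal independent set \<open>D\<close>. From $d = 1$ one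
  reaches it by raising $n$ outside \<open>D\<close> (each such cell has a neighbour in \<open>D\<close>), then lowering $d$
  outside \<open>D\<close>, then lowering $n$ on \<open>D\<close>, whose neighbours all lie outside \<open>D\<close>. The other three
  cases reduce to this one along $n = 1 \to d = 0 \to n = 0 \to d = 1$.
\<close>

text \<open>The differing coordinates can be flipped one at a time in any order, since at every
  state mixed from \<open>x\<close> and \<open>z\<close> the update of a differing coordinate points
  to \<open>z\<close>. Quantifying over all mixed \<open>w\<close> lets the induction on the Hamming
  distance pass this hypothesis on.\<close>

lemma async_dynamics_reachable_if_uniform_update:
  assumes "x \<in> bool_states m" and "z \<in> bool_states m"
    and "\<And>w i. \<lbrakk>\<forall>k. w k = x k \<or> w k = z k; i \<in> {1..m}; x i \<noteq> z i\<rbrakk> \<Longrightarrow> F w i = z i"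
  shows "x \<rightarrow>\<^sup>*\<^bsub>with_proj (async_dynamics m F)\<^esub> z"
  using assms
proof (induction "card {k \<in> {1..m}. x k \<noteq> z k}" arbitrary: x rule: less_induct)
  case less
  interpret pair_wf_digraph "async_dynamics m F"
    by (rule pair_wf_digraph_async_dynamics)
  show ?case
  proof (cases "\<exists>k\<in>{1..m}. x k \<noteq> z k")
    case False
    then have "x = z"
      using less.prems(1,2) by (auto simp: bool_states_def intro: PiE_ext)
    then show ?thesis
      using less.prems(2) reachable_refl[of z] by (simp only: async_dynamics_def) simp
  next
    case True
    then obtain k where k: "k \<in> {1..m}" "x k \<noteq> z k" by blast
    let ?x' = "x(k := z k)"
    have x': "?x' \<in> bool_states m"
      using less.prems(1) k(1) by (auto simp: bool_states_def PiE_iff extensional_def)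
    have "F x k = z k"
      using less.prems(3)[of x k] k by simp
    moreover have "z k = (\<not> x k)"
      using k(2) by simp
    ultimately have arc: "(x, ?x') \<in> parcs (async_dynamics m F)"
      using less.prems(1) k(1) by (auto simp: async_dynamics_def)
    have "{j \<in> {1..m}. ?x' j \<noteq> z j} \<subset> {j \<in> {1..m}. x j \<noteq> z j}"
      using k by auto
    then have "card {j \<in> {1..m}. ?x' j \<noteq> z j} < card {j \<in> {1..m}. x j \<noteq> z j}"
      by (simp add: psubset_card_mono)
    then have "?x' \<rightarrow>\<^sup>*\<^bsub>with_proj (async_dynamics m F)\<^esub> z"
    \<comment> \<open>\<open>?x'\<close> is itself mixed from \<open>x\<close> and \<open>z\<close>,
      so whatever is mixed from \<open>?x'\<close> and \<open>z\<close> is too.\<close>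
    proof (rule less.hyps[OF _ x' less.prems(2)])
      fix w i
      assume w: "\<forall>j. w j = ?x' j \<or> w j = z j" and i: "i \<in> {1..m}" "?x' i \<noteq> z i"
      show "F w i = z i"
      proof (rule less.prems(3))
        show "\<forall>j. w j = x j \<or> w j = z j"
          using w by (metis fun_upd_apply)
      qed (use i in \<open>auto split: if_splits\<close>)
    qed
    with arc show ?thesis
      by (rule adj_reachable_trans)
  qed
qed

text \<open>Only the values of \<open>n\<close> and \<open>d\<close> on \<open>{1..L}\<close>
  matter, so a full state such as \<open>y\<close> can itself be passed as \<open>n\<close>.\<close>

definition notch_delta_state :: "nat \<Rightarrow> (nat \<Rightarrow> bool) \<Rightarrow> (nat \<Rightarrow> bool) \<Rightarrow> nat \<Rightarrow> bool" where
  "notch_delta_state L n d = (\<lambda>k\<in>{1..2 * L}. if k \<le> L then n k else d (k - L))"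

lemma notch_delta_state_in_bool_states: "notch_delta_state L n d \<in> bool_states (2 * L)"
  by (simp add: notch_delta_state_def bool_states_def)

lemma notch_delta_state_notch: "i \<in> {1..L} \<Longrightarrow> notch_delta_state L n d i = n i"
  by (simp add: notch_delta_state_def)

lemma notch_delta_state_delta: "i \<in> {1..L} \<Longrightarrow> notch_delta_state L n d (i + L) = d i"
  by (auto simp: notch_delta_state_def)

lemma notch_delta_state_eqI:
  assumes "x \<in> bool_states (2 * L)"
    and "\<And>i. i \<in> {1..L} \<Longrightarrow> x i = n i" and "\<And>i. i \<in> {1..L} \<Longrightarrow> x (i + L) = d i"
  shows "x = notch_delta_state L n d"
proof
  fix k
  have "L < k \<Longrightarrow> k \<le> 2 * L \<Longrightarrow> k - L \<in> {1..L}" by auto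
  then show "x k = notch_delta_state L n d k"
    using assms(1) assms(2)[of k] assms(3)[of "k - L"]
    by (cases "k \<le> L") (auto simp: notch_delta_state_def bool_states_def PiE_iff extensional_def)
qed

text \<open>Notch updates read only Delta values, which stay fixed on this path, so no flip disturbs
  another. The bound on \<open>neighbours\<close> makes each \<open>j + L\<close> a genuine Delta
  coordinate.\<close>

lemma reachable_by_notch_updates:
  assumes "\<And>i. i \<in> {1..L} \<Longrightarrow> neighbours G i \<subseteq> {1..L}"
    and "\<And>i. \<lbrakk>i \<in> {1..L}; n i \<noteq> n' i\<rbrakk> \<Longrightarrow> n' i \<longleftrightarrow> (\<exists>j\<in>neighbours G i. d j)"
  shows "notch_delta_state L n d \<rightarrow>\<^sup>*\<^bsub>with_proj (async_dynamics (2 * L) (delta_notch L G))\<^esub>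
    notch_delta_state L n' d"
proof (rule async_dynamics_reachable_if_uniform_update)
  fix w i
  assume w: "\<forall>k. w k = notch_delta_state L n d k \<or> w k = notch_delta_state L n' d k"
    and i: "i \<in> {1..2 * L}" "notch_delta_state L n d i \<noteq> notch_delta_state L n' d i"
  have iL: "i \<in> {1..L}" and ni: "n i \<noteq> n' i"
    using i by (auto simp: notch_delta_state_def split: if_splits)
  have "w (j + L) = d j" if "j \<in> neighbours G i" for j
    using w[rule_format, of "j + L"] assms(1)[OF iL] that
    by (auto simp: notch_delta_state_delta subset_iff)
  then show "delta_notch L G w i = notch_delta_state L n' d i"
    using assms(2)[OF iL ni] iL by (simp add: delta_notch_notch notch_delta_state_notch)
qed (rule notch_delta_state_in_bool_states)+

text \<open>A Delta update reads only the Notch value of its own cell, which stays fixed on this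
  path.\<close>

lemma reachable_by_delta_updates:
  assumes "\<And>i. \<lbrakk>i \<in> {1..L}; d i \<noteq> d' i\<rbrakk> \<Longrightarrow> d' i \<longleftrightarrow> \<not> n i"
  shows "notch_delta_state L n d \<rightarrow>\<^sup>*\<^bsub>with_proj (async_dynamics (2 * L) (delta_notch L G))\<^esub>
    notch_delta_state L n d'"
proof (rule async_dynamics_reachable_if_uniform_update)
  fix w i
  assume w: "\<forall>k. w k = notch_delta_state L n d k \<or> w k = notch_delta_state L n d' k"
    and i: "i \<in> {1..2 * L}" "notch_delta_state L n d i \<noteq> notch_delta_state L n d' i"
  \<comment> \<open>The two states share their Notch half, so they can differ only at Delta
    coordinates.\<close>
  have "L < i"
    using i by (auto simp: notch_delta_state_def split: if_splits)
  then obtain j where j: "i = j + L" "j \<in> {1..L}"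
    using i(1) by (intro that[of "i - L"]) auto
  have "w j = n j"
    using w[rule_format, of j] j(2) by (auto simp: notch_delta_state_notch)
  then show "delta_notch L G w i = notch_delta_state L n d' i"
    using assms[of j] i(2) j by (simp add: delta_notch_delta notch_delta_state_delta)
qed (rule notch_delta_state_in_bool_states)+

theorem theorem6:
  fixes L :: nat and G :: "nat pair_pre_digraph" and x y :: "nat \<Rightarrow> bool"
  assumes "L \<ge> 1"
    and "pair_graph G"
    and "connected (with_proj G)"
    and "pverts G = {1..L}"
    and "y \<in> bool_states (2 * L)"
    and "delta_notch L G y = y"
    and "x \<in> bool_states (2 * L)"
    and "(\<forall>i\<in>{1..L}. \<not> x i) \<or> (\<forall>i\<in>{1..L}. \<not> x (i + L)) \<or>
         (\<forall>i\<in>{1..L}. x i) \<or> (\<forall>i\<in>{1..L}. x (i + L))"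
  shows "x \<rightarrow>\<^sup>*\<^bsub>with_proj (async_dynamics (2 * L) (delta_notch L G))\<^esub> y"
proof -
  interpret G: pair_graph G by fact
  interpret AD: pair_wf_digraph "async_dynamics (2 * L) (delta_notch L G)"
    by (rule pair_wf_digraph_async_dynamics)
  note trans [trans] = AD.reachable_trans
  let ?st = "notch_delta_state L"
  let ?reach = "\<lambda>u v. u \<rightarrow>\<^sup>*\<^bsub>with_proj (async_dynamics (2 * L) (delta_notch L G))\<^esub> v"
  have nbrs: "neighbours G i \<subseteq> {1..L}" for i
    using G.in_arcsD2 \<open>pverts G = {1..L}\<close> by (fastforce simp: neighbours_def)
  have y_notch: "y i \<longleftrightarrow> (\<exists>j\<in>neighbours G i. y (j + L))" if "i \<in> {1..L}" for i
    using delta_notch_notch[OF that, of G y] \<open>delta_notch L G y = y\<close> by simp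
  have y_delta: "y (i + L) \<longleftrightarrow> \<not> y i" if "i \<in> {1..L}" for i
    using delta_notch_delta[OF that, of G y] \<open>delta_notch L G y = y\<close> by simp
  have y_eq: "y = ?st y (\<lambda>i. \<not> y i)"
    by (rule notch_delta_state_eqI[OF \<open>y \<in> bool_states (2 * L)\<close>]) (auto simp: y_delta)

  have delta_one: "?reach (?st n (\<lambda>_. True)) y" for n
  proof -
    \<comment> \<open>The target is \<open>n i \<or> y i\<close> rather than \<open>y i\<close>: a
      cell with a neighbour cannot lower its Notch while all Delta values are 1, so lowering waits
      for the last phase.\<close>
    have "?reach (?st n (\<lambda>_. True)) (?st (\<lambda>i. n i \<or> y i) (\<lambda>_. True))"
      by (rule reachable_by_notch_updates) (use nbrs y_notch in auto)
    also have "?reach \<dots> (?st (\<lambda>i. n i \<or> y i) (\<lambda>i. \<not> y i))"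
      by (rule reachable_by_delta_updates) auto
    also have "?reach \<dots> (?st y (\<lambda>i. \<not> y i))"
    proof (rule reachable_by_notch_updates)
      fix i
      assume "i \<in> {1..L}"
      \<comment> \<open>The fixed-point equation of \<open>y\<close> with each Delta value
        \<open>y (j + L)\<close> rewritten as \<open>\<not> y j\<close>.\<close>
      then show "y i \<longleftrightarrow> (\<exists>j\<in>neighbours G i. \<not> y j)"
        using y_notch y_delta nbrs by blast
    qed (rule nbrs)
    finally show ?thesis
      using y_eq by simp
  qed
  \<comment> \<open>A constant half drives the other half to a constant: \<open>n = 0\<close> sends
    all \<open>d\<close> to 1, \<open>d = 0\<close> sends all \<open>n\<close> to 0, and
    \<open>n = 1\<close> sends all \<open>d\<close> to 0. Each case thus leads into the one before
    it.\<close>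
  have notch_zero: "?reach (?st (\<lambda>_. False) d) y" for d
    by (rule trans[OF _ delta_one], rule reachable_by_delta_updates) auto
  have delta_zero: "?reach (?st n (\<lambda>_. False)) y" for n
    by (rule trans[OF _ notch_zero], rule reachable_by_notch_updates) (use nbrs in auto)
  have notch_one: "?reach (?st (\<lambda>_. True) d) y" for d
    by (rule trans[OF _ delta_zero], rule reachable_by_delta_updates) auto

  note x_eqI = notch_delta_state_eqI[OF \<open>x \<in> bool_states (2 * L)\<close>]
  consider "\<forall>i\<in>{1..L}. \<not> x i" | "\<forall>i\<in>{1..L}. \<not> x (i + L)"
    | "\<forall>i\<in>{1..L}. x i" | "\<forall>i\<in>{1..L}. x (i + L)"
    using assms(8) by blast
  then show ?thesis
  proof cases
    case 1
    then have "x = ?st (\<lambda>_. False) (\<lambda>i. x (i + L))" by (intro x_eqI) auto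
    then show ?thesis by (metis notch_zero)
  next
    case 2
    then have "x = ?st x (\<lambda>_. False)" by (intro x_eqI) auto
    then show ?thesis by (metis delta_zero)
  next
    case 3
    then have "x = ?st (\<lambda>_. True) (\<lambda>i. x (i + L))" by (intro x_eqI) auto
    then show ?thesis by (metis notch_one)
  next
    case 4
    then have "x = ?st x (\<lambda>_. True)" by (intro x_eqI) auto
    then show ?thesis by (metis delta_one)
  qed
qed

end
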